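(* Let $X$ be a $T_3$ space and $f\colon X\to X$ a continuous map such that $(X,f)$ has the strong open cover specification property. Then $(X,f)$ is Devaney chaotic.
   Context: $\mathbb{N}=\{1,2,\dots\}$; for integers $a\le b$, $[a,b]$ denotes the set of integers $k$ with $a\le k\le b$. A $T_3$ space is a regular $T_1$ space. For $N\in\mathbb{N}$, an $N$-spaced specification $\xi=\{f^{[a_i,b_i]}(x_i)\}_{i=1}^n$ consists of $n\in\mathbb{N}$, points $x_1,\dots,x_n\in X$ and non-negative integers $a_1\le b_1<a_2\le b_2<\cdots<a_n\le b_n$ with $a_{i+1}-b_i\ge N$ for $1\le i\le n-1$. For an open cover $\mathcal{U}$ of $X$, $y\in X$ $\mathcal{U}$-traces $\xi$ if for every $i\in[1,n]$ and $k\in[a_i,b_i]$ there is $U\in\mathcal{U}$ with $(f^k(y),f^k(x_i))\in U\times U$. $(X,f)$ has the strong open cover specification property if for every open cover $\mathcal{U}$ of $X$ there is $N\in\mathbb{N}$ such that every $N$-spaced specification $\{f^{[a_i,b_i]}(x_i)\}_{i=1}^n$ is $\mathcal{U}$-traced by some $y\in X$ satisfying $f^l(y)=y$ for some $l\ge N+b_n-a_1$ (so the tracing point can be chosen periodic). $(X,f)$ has sensitive dependence on initial conditions if there is an open cover $\mathcal{U}$ of $X$ such that for every $x\in X$ and every open neighborhood $G$ of $x$ there are $y\in G$ and $n\in\mathbb{N}$ with $(f^n(y),f^n(x))\notin U\times U$ for all $U\in\mathcal{U}$. $(X,f)$ is topologically transitive if for all nonempty open $U,V\subseteq X$ there is $n\in\mathbb{N}\cup\{0\}$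 with $U\cap f^n(V)\ne\varnothing$. A point $x$ is periodic if $f^p(x)=x$ for some $p\in\mathbb{N}$. $(X,f)$ is Devaney chaotic if it has sensitive dependence on initial conditions, is topologically transitive, and its set of periodic points is dense in $X$.
   Formalization: The space X is additionally assumed to have at least two points: for a one-point space with the identity map the strong open cover specification property holds but sensitive dependence on initial conditions fails. *)

theory Defs
  imports "HOL-Analysis.Analysis"
begin

text \<open>
  Throughout, the space is the whole type \<open>'a\<close>, and \<open>f ^^ k\<close> is the \<open>k\<close>-th iterate of \<open>f\<close>.
\<close>

definition open_cover :: "'a::topological_space set set \<Rightarrow> bool" where
  "open_cover \<U> \<longleftrightarrow> (\<forall>U\<in>\<U>. open U) \<and> \<Union>\<U> = UNIV"

text \<open>
  A specification with \<open>n\<close> pieces is given by families \<open>a\<close>, \<open>b\<close> of times and \<open>x\<close> of points, of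
  which only the values at the indices \<open>1, \<dots>, n\<close> matter.
\<close>

definition spaced_specification :: "nat \<Rightarrow> nat \<Rightarrow> (nat \<Rightarrow> nat) \<Rightarrow> (nat \<Rightarrow> nat) \<Rightarrow> bool" where
  "spaced_specification N n a b \<longleftrightarrow>
     n \<ge> 1 \<and>
     (\<forall>i\<in>{1..n}. a i \<le> b i) \<and>
     (\<forall>i. 1 \<le> i \<and> i < n \<longrightarrow> b i < a (i + 1) \<and> b i + N \<le> a (i + 1))"

definition traces :: "('a \<Rightarrow> 'a) \<Rightarrow> 'a set set \<Rightarrow> nat \<Rightarrow> (nat \<Rightarrow> nat) \<Rightarrow> (nat \<Rightarrow> nat) \<Rightarrow> (nat \<Rightarrow> 'a) \<Rightarrow> 'a \<Rightarrow> bool"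
  where
  "traces f \<U> n a b x y \<longleftrightarrow>
     (\<forall>i\<in>{1..n}. \<forall>k\<in>{a i..b i}. \<exists>U\<in>\<U>. ((f ^^ k) y, (f ^^ k) (x i)) \<in> U \<times> U)"

text \<open>
  In the bound on \<open>l\<close> the subtraction on natural numbers does not truncate, since
  \<open>a 1 \<le> b n\<close> for every specification.
\<close>

definition strong_open_cover_specification :: "('a::topological_space \<Rightarrow> 'a) \<Rightarrow> bool" where
  "strong_open_cover_specification f \<longleftrightarrow>
     (\<forall>\<U>. open_cover \<U> \<longrightarrow>
        (\<exists>N\<ge>1. \<forall>n a b x. spaced_specification N n a b \<longrightarrow>
           (\<exists>y. traces f \<U> n a b x y \<and> (\<exists>l. l \<ge> N + b n - a 1 \<and> (f ^^ l) y = y))))"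

definition sensitive :: "('a::topological_space \<Rightarrow> 'a) \<Rightarrow> bool" where
  "sensitive f \<longleftrightarrow>
     (\<exists>\<U>. open_cover \<U> \<and>
        (\<forall>x G. open G \<and> x \<in> G \<longrightarrow>
           (\<exists>y\<in>G. \<exists>n\<ge>1. \<forall>U\<in>\<U>. ((f ^^ n) y, (f ^^ n) x) \<notin> U \<times> U)))"

definition topologically_transitive :: "('a::topological_space \<Rightarrow> 'a) \<Rightarrow> bool" where
  "topologically_transitive f \<longleftrightarrow>
     (\<forall>U V. open U \<and> U \<noteq> {} \<and> open V \<and> V \<noteq> {} \<longrightarrow> (\<exists>n. U \<inter> (f ^^ n) ` V \<noteq> {}))"

definition periodic_points :: "('a \<Rightarrow> 'a) \<Rightarrow> 'a set" where
  "periodic_points f = {x. \<exists>p\<ge>1. (f ^^ p) x = x}"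

definition devaney_chaotic :: "('a::topological_space \<Rightarrow> 'a) \<Rightarrow> bool" where
  "devaney_chaotic f \<longleftrightarrow>
     sensitive f \<and> topologically_transitive f \<and> closure (periodic_points f) = UNIV"

end

theory Submission
  imports Defs
begin

text \<open>
  Tracing at single times is all that is needed. If the members of an open cover that contain a
  point \<open>x\<close> all lie in a neighbourhood \<open>G\<close> of \<open>x\<close>, then a point that traces \<open>x\<close> at time \<open>0\<close> lies
  in \<open>G\<close>; in a \<open>T\<^sub>1\<close> space the cover by \<open>G\<close> and the complement of \<open>x\<close> is of this kind. Since the
  tracing point can be taken periodic, periodic points are dense.

  A specification only prescribes values of the form \<open>f\<^sup>m(x)\<close> at time \<open>m\<close>, and \<open>f\<close> is not assumed
  surjective. Density of the periodic points removes this obstacle: if \<open>w\<close> is periodic and \<open>m\<close> is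
  a multiple of its period, then \<open>f\<^sup>m(w) = w\<close>, so tracing a point of \<open>G\<close> at time \<open>0\<close> and \<open>w\<close> at
  time \<open>m\<close> yields an orbit that starts in \<open>G\<close> and is close to \<open>w\<close> at time \<open>m\<close>. This works for all
  large multiples \<open>m\<close> of the period (\<open>eventually_visits_periodic_point\<close>), and transitivity is
  immediate.

  Common multiples of two periods give a single time \<open>m\<close> at which points of \<open>G\<close> reach small
  neighbourhoods of two different periodic points. Regularity provides a cover
  (\<open>separating_cover\<close>) in which no point is close to both of these neighbourhoods, so one of
  the two orbits is far at time \<open>m\<close> from the orbit of any prescribed point of \<open>G\<close>. The
  cover does not depend on \<open>G\<close>, which is sensitivity.
\<close>

text \<open>
  The cover is the common refinement of \<open>{G, -{g}}\<close> and \<open>{W, -{w}}\<close>. Refining lets \<open>G\<close> and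
  \<open>W\<close> overlap, and allows \<open>g = w\<close>.
\<close>

lemma localizing_cover:
  fixes g w :: "'a::t1_space"
  assumes "open G" "g \<in> G" "open W" "w \<in> W"
  shows "\<exists>\<U>. open_cover \<U> \<and> (\<forall>U\<in>\<U>. g \<in> U \<longrightarrow> U \<subseteq> G) \<and> (\<forall>U\<in>\<U>. w \<in> U \<longrightarrow> U \<subseteq> W)"
proof -
  let ?\<U> = "{G \<inter> W, G \<inter> - {w}, - {g} \<inter> W, - {g} \<inter> - {w}}"
  have "open_cover ?\<U>"
    unfolding open_cover_def using assms by auto
  then show ?thesis
    by (intro exI[of _ ?\<U>]) auto
qed

lemma periodic_points_dense:
  fixes f :: "'a::t1_space \<Rightarrow> 'a"
  assumes spec: "strong_open_cover_specification f"
    and "open G" "g \<in> G"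
  obtains y p where "y \<in> G" "p \<ge> 1" "(f ^^ p) y = y"
proof -
  obtain \<U> where cover: "open_cover \<U>" and small: "\<forall>U\<in>\<U>. g \<in> U \<longrightarrow> U \<subseteq> G"
    using localizing_cover[OF assms(2,3) assms(2,3)] by (elim exE conjE) (rule that)
  obtain N where "N \<ge> 1" and N: "\<And>n a b x. spaced_specification N n a b \<Longrightarrow>
      \<exists>y. traces f \<U> n a b x y \<and> (\<exists>l. l \<ge> N + b n - a 1 \<and> (f ^^ l) y = y)"
    using spec cover unfolding strong_open_cover_specification_def by blast
  have "spaced_specification N 1 (\<lambda>_. 0) (\<lambda>_. 0)"
    by (simp add: spaced_specification_def)
  from N[OF this, of "\<lambda>_. g"] obtain y l where
    trace: "traces f \<U> 1 (\<lambda>_. 0) (\<lambda>_. 0) (\<lambda>_. g) y" and "l \<ge> N" "(f ^^ l) y = y"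
    by auto
  moreover have "y \<in> G"
    using trace small by (auto simp: traces_def)
  ultimately show thesis
    using that[of y l] \<open>N \<ge> 1\<close> by simp
qed

lemma funpow_multiple_of_period:
  assumes "(f ^^ p) w = w" "p dvd m"
  shows "(f ^^ m) w = w"
  using assms by (metis dvd_imp_mod_0 funpow_0 funpow_mod_eq)

lemma eventually_visits_periodic_point:
  fixes f :: "'a::t1_space \<Rightarrow> 'a"
  assumes spec: "strong_open_cover_specification f"
    and "open G" "g \<in> G" "open W" "w \<in> W" and period: "(f ^^ p) w = w"
  shows "\<exists>N. \<forall>m\<ge>N. p dvd m \<longrightarrow> (\<exists>y\<in>G. (f ^^ m) y \<in> W)"
proof -
  obtain \<U> where cover: "open_cover \<U>"
    and small: "\<forall>U\<in>\<U>. g \<in> U \<longrightarrow> U \<subseteq> G" "\<forall>U\<in>\<U>. w \<in> U \<longrightarrow> U \<subseteq> W"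
    using localizing_cover[OF assms(2-5)] by (elim exE conjE) (rule that)
  obtain N where "N \<ge> 1" and N: "\<And>n a b x. spaced_specification N n a b \<Longrightarrow>
      \<exists>y. traces f \<U> n a b x y \<and> (\<exists>l. l \<ge> N + b n - a 1 \<and> (f ^^ l) y = y)"
    using spec cover unfolding strong_open_cover_specification_def by blast
  have "\<exists>y\<in>G. (f ^^ m) y \<in> W" if "m \<ge> N" "p dvd m" for m
  proof -
    define t where "t i = (if i = 1 then 0 else m)" for i :: nat
    define x where "x i = (if i = 1 then g else w)" for i :: nat
    have "spaced_specification N 2 t t"
      using \<open>N \<ge> 1\<close> \<open>m \<ge> N\<close> by (auto simp: spaced_specification_def t_def)
    from N[OF this] obtain y where trace: "traces f \<U> 2 t t x y"
      by blast
    have near: "\<exists>U\<in>\<U>. (f ^^ t i) y \<in> U \<and> (f ^^ t i) (x i) \<in> U" if "i \<in> {1..2}" for i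
      using trace that by (auto simp: traces_def)
    have "y \<in> G"
      using near[of 1] small(1) by (auto simp: t_def x_def)
    moreover have "(f ^^ m) y \<in> W"
      using near[of 2] small(2) funpow_multiple_of_period[OF period \<open>p dvd m\<close>]
      by (auto simp: t_def x_def)
    ultimately show ?thesis
      by blast
  qed
  then show ?thesis
    by blast
qed

lemma strong_specification_imp_transitive:
  fixes f :: "'a::t1_space \<Rightarrow> 'a"
  assumes spec: "strong_open_cover_specification f"
  shows "topologically_transitive f"
  unfolding topologically_transitive_def
proof (intro allI impI)
  fix U V :: "'a set"
  assume "open U \<and> U \<noteq> {} \<and> open V \<and> V \<noteq> {}"
  then obtain u v where "open U" "u \<in> U" "open V" "v \<in> V"
    by blast
  obtain w p where "w \<in> U" "p \<ge> 1" "(f ^^ p) w = w"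
    using periodic_points_dense[OF spec \<open>open U\<close> \<open>u \<in> U\<close>] .
  then obtain N where "\<forall>m\<ge>N. p dvd m \<longrightarrow> (\<exists>y\<in>V. (f ^^ m) y \<in> U)"
    using eventually_visits_periodic_point[OF spec \<open>open V\<close> \<open>v \<in> V\<close> \<open>open U\<close>] by blast
  with \<open>p \<ge> 1\<close> have "\<exists>y\<in>V. (f ^^ (p * N)) y \<in> U"
    by simp
  then show "\<exists>n. U \<inter> (f ^^ n) ` V \<noteq> {}"
    by blast
qed

text \<open>
  Separate \<open>p\<close> and \<open>q\<close> by disjoint open sets \<open>P\<^sub>0\<close> and \<open>Q\<^sub>0\<close>. Regularity gives smaller
  neighbourhoods \<open>P \<subseteq> C \<subseteq> P\<^sub>0\<close> and \<open>Q \<subseteq> D \<subseteq> Q\<^sub>0\<close> with \<open>C\<close> and \<open>D\<close> closed. In the cover by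
  \<open>P\<^sub>0\<close>, \<open>Q\<^sub>0\<close> and the complement of \<open>C \<union> D\<close>, the only member that meets \<open>P\<close> is \<open>P\<^sub>0\<close>, and the
  only one that meets \<open>Q\<close> is \<open>Q\<^sub>0\<close>; no \<open>z\<close> lies in both.
\<close>

lemma separating_cover:
  fixes p q :: "'a::t3_space"
  assumes "p \<noteq> q"
  obtains \<U> P Q where "open_cover \<U>" "open P" "p \<in> P" "open Q" "q \<in> Q"
    "\<forall>z. (\<forall>u\<in>P. \<forall>U\<in>\<U>. (u, z) \<notin> U \<times> U) \<or> (\<forall>u\<in>Q. \<forall>U\<in>\<U>. (u, z) \<notin> U \<times> U)"
proof -
  have shrink: "\<exists>P C. open P \<and> closed C \<and> x \<in> P \<and> P \<subseteq> C \<and> C \<subseteq> P\<^sub>0"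
    if "open P\<^sub>0" "x \<in> P\<^sub>0" for x :: 'a and P\<^sub>0
  proof -
    have "closed (- P\<^sub>0)" "x \<notin> - P\<^sub>0"
      using that by auto
    then obtain P V where "open P" "open V" "x \<in> P" "- P\<^sub>0 \<subseteq> V" "P \<inter> V = {}"
      by (meson t3_space)
    then show ?thesis
      by (intro exI[of _ P] exI[of _ "- V"]) auto
  qed
  obtain P\<^sub>0 Q\<^sub>0 where P\<^sub>0: "open P\<^sub>0" "p \<in> P\<^sub>0" and Q\<^sub>0: "open Q\<^sub>0" "q \<in> Q\<^sub>0" and disj: "P\<^sub>0 \<inter> Q\<^sub>0 = {}"
    using hausdorff[OF assms] by blast
  obtain P C where P: "open P" "closed C" "p \<in> P" "P \<subseteq> C" "C \<subseteq> P\<^sub>0"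
    using shrink[OF P\<^sub>0] by blast
  obtain Q D where Q: "open Q" "closed D" "q \<in> Q" "Q \<subseteq> D" "D \<subseteq> Q\<^sub>0"
    using shrink[OF Q\<^sub>0] by blast
  let ?\<U> = "{P\<^sub>0, Q\<^sub>0, - (C \<union> D)}"
  have "open_cover ?\<U>"
    unfolding open_cover_def using P\<^sub>0(1) Q\<^sub>0(1) P Q by auto
  moreover have "(\<forall>u\<in>P. \<forall>U\<in>?\<U>. (u, z) \<notin> U \<times> U) \<or> (\<forall>u\<in>Q. \<forall>U\<in>?\<U>. (u, z) \<notin> U \<times> U)" for z
    using disj P(4,5) Q(4,5) by (cases "z \<in> P\<^sub>0") auto
  ultimately show thesis
    by (intro that[of ?\<U> P Q] allI P(1,3) Q(1,3))
qed

lemma strong_specification_imp_sensitive: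
  fixes f :: "'a::t3_space \<Rightarrow> 'a"
  assumes spec: "strong_open_cover_specification f" and "\<exists>p q :: 'a. p \<noteq> q"
  shows "sensitive f"
proof -
  obtain p q :: 'a where "p \<noteq> q"
    using assms(2) by blast
  obtain \<U> P Q where cover: "open_cover \<U>" and P: "open P" "p \<in> P" and Q: "open Q" "q \<in> Q"
    and sep: "\<forall>z. (\<forall>u\<in>P. \<forall>U\<in>\<U>. (u, z) \<notin> U \<times> U) \<or> (\<forall>u\<in>Q. \<forall>U\<in>\<U>. (u, z) \<notin> U \<times> U)"
    using separating_cover[OF \<open>p \<noteq> q\<close>] .
  obtain v k where v: "v \<in> P" "k \<ge> 1" "(f ^^ k) v = v"
    using periodic_points_dense[OF spec P] .
  obtain w l where w: "w \<in> Q" "l \<ge> 1" "(f ^^ l) w = w"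
    using periodic_points_dense[OF spec Q] .
  have "\<exists>y\<in>G. \<exists>n\<ge>1. \<forall>U\<in>\<U>. ((f ^^ n) y, (f ^^ n) x) \<notin> U \<times> U" if G: "open G" "x \<in> G" for x G
  proof -
    obtain M where M: "\<forall>m\<ge>M. k dvd m \<longrightarrow> (\<exists>y\<in>G. (f ^^ m) y \<in> P)"
      using eventually_visits_periodic_point[OF spec G P(1) v(1,3)] by blast
    obtain N where N: "\<forall>m\<ge>N. l dvd m \<longrightarrow> (\<exists>y\<in>G. (f ^^ m) y \<in> Q)"
      using eventually_visits_periodic_point[OF spec G Q(1) w(1,3)] by blast
    \<comment> \<open>The summand \<open>1\<close> keeps \<open>m\<close> positive when both thresholds are \<open>0\<close>.\<close>
    define m where "m = k * l * (M + N + 1)"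
    have "k * l \<ge> 1"
      using v(2) w(2) by simp
    then have "1 * (M + N + 1) \<le> k * l * (M + N + 1)"
      by (rule mult_le_mono1)
    then have "m \<ge> M" "m \<ge> N" "m \<ge> 1" "k dvd m" "l dvd m"
      by (auto simp: m_def)
    moreover from this obtain y y' where "y \<in> G" "(f ^^ m) y \<in> P" "y' \<in> G" "(f ^^ m) y' \<in> Q"
      using M N by meson
    ultimately show ?thesis
      using sep by meson
  qed
  with cover show ?thesis
    unfolding sensitive_def by blast
qed

theorem theorem4p7:
  fixes f :: "'a::t3_space \<Rightarrow> 'a"
  assumes two_points: "\<exists>p q :: 'a. p \<noteq> q"
    and cont: "continuous_on UNIV f"
    and strong_spec: "strong_open_cover_specification f"
  shows "devaney_chaotic f"
proof -
  have "x \<in> closure (periodic_points f)" for x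
    unfolding closure_iff_nhds_not_empty
  proof (intro allI impI)
    fix A V assume "V \<subseteq> A" "open V" "x \<in> V"
    then obtain y p where "y \<in> V" "p \<ge> 1" "(f ^^ p) y = y"
      using periodic_points_dense[OF strong_spec] by blast
    with \<open>V \<subseteq> A\<close> show "periodic_points f \<inter> A \<noteq> {}"
      by (auto simp: periodic_points_def)
  qed
  then show ?thesis
    using strong_specification_imp_sensitive[OF strong_spec two_points]
      strong_specification_imp_transitive[OF strong_spec]
    unfolding devaney_chaotic_def by blast
qed

end
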